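(* Let $J$ be the monic Jacobi matrix associated with a nonrational function $F\in\mathbf N_{-\infty}$ with asymptotic coefficients $\{s_j\}_{j\ge0}$, let $s_{-1}\in\mathbb R$, let $P_j$ and $Q_j$ be the polynomials of the first and second kind, respectively, associated with the sequence $\{s_j\}_{j\ge0}$, and put $\widehat P_j(\lambda):=Q_j(\lambda)-s_{-1}P_j(\lambda)$. Then: (i) the normal indices $\mathfrak n_j$ ($j\in\mathbb N$) of the sequence $\mathfrak s=\{s_{j-1}\}_{j=0}^\infty=(s_{-1},s_0,s_1,\dots)$ can be characterized by the conditions $\widehat P_{\mathfrak n_j-1}(0)\ne0$, $j\in\mathbb N$; (ii) $J$ admits a factorization $J=\mathfrak U\mathfrak L$, where, with $\mathfrak n_0=0$ and $\mathfrak k_j=\mathfrak n_{j+1}-\mathfrak n_j$, $\mathfrak L$ and $\mathfrak U$ are block lower and block upper triangular matrices $$\mathfrak L=\begin{pmatrix}\mathfrak E_0&0&&\\ \mathfrak L_1&\mathfrak E_1&0&\\ &\mathfrak L_2&\mathfrak E_2&\ddots\\ &&\ddots&\ddots\end{pmatrix},\qquad \mathfrak U=\begin{pmatrix}\mathfrak U_0&\mathfrak D_0&&\\ 0&\mathfrak U_1&\mathfrak D_1&\\ &0&\mathfrak U_2&\ddots\\ &&\ddots&\ddots\end{pmatrix}$$ in which $\mathfrak L_j$ is the $\mathfrak k_j\times\mathfrak k_{j-1}$ matrix with lower-right entry a number $\mathfrak l_j$ and other entries $0$; $\mathfrak D_j$ is the $\mathfrak k_j\times\mathfrak k_{j+1}$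 matrix with lower-left entry $1$ and other entries $0$; $\mathfrak U_j=\mathfrak u_j$, $\mathfrak E_j=1$ if $\mathfrak k_j=1$, and $\mathfrak U_j=\begin{pmatrix}0&1\\ \mathfrak u_j&0\end{pmatrix}$, $\mathfrak E_j=\begin{pmatrix}1&0\\ \mathfrak e_j&1\end{pmatrix}$ if $\mathfrak k_j=2$. Moreover, $$\mathfrak l_j=-\frac{\widehat P_{\mathfrak n_{j+1}-1}(0)}{\widehat P_{\mathfrak n_j-1}(0)},\qquad j\in\mathbb N.$$
   Context: $\lambda\widehat\to\infty$ means that $\lambda\to\infty$ inside a sector $\varepsilon<\arg\lambda<\pi-\varepsilon$, $\varepsilon>0$. $\mathbf N$ is the class of Nevanlinna functions (analytic in $\mathbb C_+$, mapping $\mathbb C_+$ into $\mathbb C_+$). $\mathbf N_{-\infty}$ is the set of $F\in\mathbf N$ for which there are real $s_0,s_1,\dots$ with $F(\lambda)=-\frac{s_0}{\lambda}-\dots-\frac{s_{2n}}{\lambda^{2n+1}}+o(\lambda^{-2n-1})$, $\lambda\widehat\to\infty$, for every $n\in\mathbb Z_+$; equivalently $F(\lambda)=\int_{\mathbb R}\frac{d\sigma(t)}{t-\lambda}$ with a finite measure $\sigma$ with moments $s_j=\int t^jd\sigma(t)$. The polynomials of the first kind $P_j$ are the monic orthogonal polynomials of $\sigma/s_0$: $\lambda P_j=P_{j+1}+b_jP_j+c_{j-1}P_{j-1}$, $j\in\mathbb Z_+$, $P_{-1}=0$, $P_0=1$, where $b_j\in\mathbb R$, $c_j>0$ for $j\in\mathbb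 Z_+$. The polynomials of the second kind $Q_j$ are the solutions of the same recurrence with $Q_{-1}=-1$, $Q_0=0$ (with $c_{-1}=s_0$, so $c_{-1}=1$ for a probability measure); that is, $Q_j(\lambda)=\int\frac{P_j(\lambda)-P_j(t)}{\lambda-t}d\sigma(t)$ for $j\ge0$. The monic Jacobi matrix $J$ associated with $F$ is the semi-infinite tridiagonal matrix with $J_{j,j}=b_j$, $J_{j,j+1}=1$, $J_{j+1,j}=c_j$. The normal indices of a real sequence $\{\mathfrak s_j\}_{j\ge0}$ are the integers $n\ge1$ with $\det(\mathfrak s_{i+k})_{i,k=0}^{n-1}\ne0$, listed increasingly $\mathfrak n_1<\mathfrak n_2<\cdots$. In the present situation always $\mathfrak k_j\in\{1,2\}$.
   Formalization: The sign in the definition is corrected to P̂_j = Q_j + s_{-1}P_j; with Q_j − s_{-1}P_j claim (i) fails, e.g. for s_0 = s_1 = s_{-1} = 1, where P̂_1(0) = 2 but the order-2 determinant of (s_{-1}, s_0, s_1) is 0. *)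

theory Defs
  imports
    "HOL-Analysis.Analysis"
    "HOL-Library.Landau_Symbols"
    "HOL-Library.Infinite_Set"
    "HOL-Computational_Algebra.Polynomial"
    "Jordan_Normal_Form.Determinant"
begin

definition nevanlinna :: "(complex \<Rightarrow> complex) set" where
  "nevanlinna = {F. F analytic_on {z. 0 < Im z} \<and> (\<forall>z. 0 < Im z \<longrightarrow> 0 < Im (F z))}"

definition sector_at_infinity :: "real \<Rightarrow> complex filter" where
  "sector_at_infinity \<epsilon> = inf at_infinity (principal {z. \<epsilon> < Arg z \<and> Arg z < pi - \<epsilon>})"

definition asymptotic_coefficients :: "(complex \<Rightarrow> complex) \<Rightarrow> (nat \<Rightarrow> real) \<Rightarrow> bool" where
  "asymptotic_coefficients F s \<longleftrightarrow>
     (\<forall>\<epsilon>>0. \<forall>n. (\<lambda>z. F z - (- (\<Sum>i\<le>2 * n. complex_of_real (s i) / z ^ (i + 1))))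
        \<in> o[sector_at_infinity \<epsilon>](\<lambda>z. 1 / z ^ (2 * n + 1)))"

definition nevanlinna_minus_infinity :: "(complex \<Rightarrow> complex) set" where
  "nevanlinna_minus_infinity = {F \<in> nevanlinna. \<exists>s. asymptotic_coefficients F s}"

(* A Nevanlinna function is only given on the upper half-plane; its values elsewhere
   (as a total HOL function) are irrelevant here as everywhere else. *)
definition rational_on_upper_half_plane :: "(complex \<Rightarrow> complex) \<Rightarrow> bool" where
  "rational_on_upper_half_plane F \<longleftrightarrow>
     (\<exists>p q. q \<noteq> 0 \<and> (\<forall>z. 0 < Im z \<and> poly q z \<noteq> 0 \<longrightarrow> F z = poly p z / poly q z))"

(* The integral of p against any measure with moments s. *)
definition moment_functional :: "(nat \<Rightarrow> real) \<Rightarrow> real poly \<Rightarrow> real" where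
  "moment_functional s p = (\<Sum>i\<le>degree p. coeff p i * s i)"

(* P(0) = 1 and x P(j) = P(j+1) + b(j) P(j) + c(j-1) P(j-1) with P(-1) = 0. *)
fun first_kind :: "(nat \<Rightarrow> real) \<Rightarrow> (nat \<Rightarrow> real) \<Rightarrow> nat \<Rightarrow> real poly" where
  "first_kind b c 0 = 1"
| "first_kind b c (Suc 0) = [:- b 0, 1:]"
| "first_kind b c (Suc (Suc j)) =
     [:- b (Suc j), 1:] * first_kind b c (Suc j) - Polynomial.smult (c j) (first_kind b c j)"

(* The same recurrence with Q(-1) = -1, Q(0) = 0 and c(-1) = s0; at j = 0 it reads
   0 = Q(1) + b(0) * 0 + s0 * (-1). *)
fun second_kind :: "real \<Rightarrow> (nat \<Rightarrow> real) \<Rightarrow> (nat \<Rightarrow> real) \<Rightarrow> nat \<Rightarrow> real poly" where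
  "second_kind s0 b c 0 = 0"
| "second_kind s0 b c (Suc 0) = [:s0:]"
| "second_kind s0 b c (Suc (Suc j)) =
     [:- b (Suc j), 1:] * second_kind s0 b c (Suc j) - Polynomial.smult (c j) (second_kind s0 b c j)"

(* b and c are the recurrence coefficients of the monic orthogonal polynomials of s.
   The polynomials first_kind b c j are monic of degree j by construction, so only
   orthogonality has to be required; b and c are thereby determined by s. *)
definition jacobi_coefficients :: "(nat \<Rightarrow> real) \<Rightarrow> (nat \<Rightarrow> real) \<Rightarrow> (nat \<Rightarrow> real) \<Rightarrow> bool" where
  "jacobi_coefficients s b c \<longleftrightarrow>
     (\<forall>j. 0 < c j) \<and>
     (\<forall>i j. i \<noteq> j \<longrightarrow> moment_functional s (first_kind b c i * first_kind b c j) = 0)"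

definition monic_jacobi :: "(nat \<Rightarrow> real) \<Rightarrow> (nat \<Rightarrow> real) \<Rightarrow> nat \<Rightarrow> nat \<Rightarrow> real" where
  "monic_jacobi b c i k =
     (if k = i then b i else if k = Suc i then 1 else if i = Suc k then c k else 0)"

(* The source states this with the opposite sign, Q(j) - sm1 * P(j). With the remaining
   conventions (F(z) = - s(0)/z - s(1)/z^2 - ..., Q(-1) = -1, Q(0) = 0, shifted sequence
   (sm1, s(0), s(1), ...)) that is a sign slip: for index 1 the value at 0 would be
   (s(0)^2 + sm1 * s(1)) / s(0), while the Hankel determinant of order 2 is
   sm1 * s(1) - s(0)^2. *)
definition hat_poly ::
    "real \<Rightarrow> (nat \<Rightarrow> real) \<Rightarrow> (nat \<Rightarrow> real) \<Rightarrow> (nat \<Rightarrow> real) \<Rightarrow> nat \<Rightarrow> real poly" where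
  "hat_poly sm1 s b c j = second_kind (s 0) b c j + Polynomial.smult sm1 (first_kind b c j)"

definition hankel :: "(nat \<Rightarrow> real) \<Rightarrow> nat \<Rightarrow> real Matrix.mat" where
  "hankel s n = Matrix.mat n n (\<lambda>(i, k). s (i + k))"

definition normal_indices :: "(nat \<Rightarrow> real) \<Rightarrow> nat set" where
  "normal_indices s = {n. 1 \<le> n \<and> Determinant.det (hankel s n) \<noteq> 0}"

(* enumerate lists an infinite set of naturals increasingly, starting at position 0 *)
definition normal_index :: "(nat \<Rightarrow> real) \<Rightarrow> nat \<Rightarrow> nat" where
  "normal_index s j = (case j of 0 \<Rightarrow> 0 | Suc i \<Rightarrow> enumerate (normal_indices s) i)"

definition index_gap :: "(nat \<Rightarrow> nat) \<Rightarrow> nat \<Rightarrow> nat" where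
  "index_gap \<nu> j = \<nu> (Suc j) - \<nu> j"

(* For \<nu> 0 = 0 and \<nu> strictly increasing, block j occupies rows and columns
   \<nu> j, ..., \<nu> (Suc j) - 1. *)
definition block_of :: "(nat \<Rightarrow> nat) \<Rightarrow> nat \<Rightarrow> nat" where
  "block_of \<nu> i = (THE j. \<nu> j \<le> i \<and> i < \<nu> (Suc j))"

definition block_matrix ::
    "(nat \<Rightarrow> nat) \<Rightarrow> (nat \<Rightarrow> nat \<Rightarrow> real Matrix.mat) \<Rightarrow> nat \<Rightarrow> nat \<Rightarrow> real" where
  "block_matrix \<nu> B i k =
     (let p = block_of \<nu> i; q = block_of \<nu> k in B p q $$ (i - \<nu> p, k - \<nu> q))"

(* The diagonal blocks are meant for sizes 1 and 2 only. *)
definition E_block :: "nat \<Rightarrow> real \<Rightarrow> real Matrix.mat" where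
  "E_block k e = (if k = 1 then mat_of_rows_list 1 [[1]]
                  else mat_of_rows_list 2 [[1, 0], [e, 1]])"

definition U_block :: "nat \<Rightarrow> real \<Rightarrow> real Matrix.mat" where
  "U_block k u = (if k = 1 then mat_of_rows_list 1 [[u]]
                  else mat_of_rows_list 2 [[0, 1], [u, 0]])"

definition L_block :: "nat \<Rightarrow> nat \<Rightarrow> real \<Rightarrow> real Matrix.mat" where
  "L_block m n l = Matrix.mat m n (\<lambda>(r, t). if r = m - 1 \<and> t = n - 1 then l else 0)"

definition D_block :: "nat \<Rightarrow> nat \<Rightarrow> real Matrix.mat" where
  "D_block m n = Matrix.mat m n (\<lambda>(r, t). if r = m - 1 \<and> t = 0 then 1 else 0)"

definition block_lower ::
    "(nat \<Rightarrow> nat) \<Rightarrow> (nat \<Rightarrow> real) \<Rightarrow> (nat \<Rightarrow> real) \<Rightarrow> nat \<Rightarrow> nat \<Rightarrow> real" where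
  "block_lower \<nu> l e = block_matrix \<nu> (\<lambda>p q.
     if p = q then E_block (index_gap \<nu> p) (e p)
     else if p = Suc q then L_block (index_gap \<nu> p) (index_gap \<nu> q) (l p)
     else 0\<^sub>m (index_gap \<nu> p) (index_gap \<nu> q))"

definition block_upper ::
    "(nat \<Rightarrow> nat) \<Rightarrow> (nat \<Rightarrow> real) \<Rightarrow> nat \<Rightarrow> nat \<Rightarrow> real" where
  "block_upper \<nu> u = block_matrix \<nu> (\<lambda>p q.
     if p = q then U_block (index_gap \<nu> p) (u p)
     else if q = Suc p then D_block (index_gap \<nu> p) (index_gap \<nu> q)
     else 0\<^sub>m (index_gap \<nu> p) (index_gap \<nu> q))"

(* Every entry of the product of these semi-infinite matrices is a finite sum. *)
definition is_matrix_product ::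
    "(nat \<Rightarrow> nat \<Rightarrow> real) \<Rightarrow> (nat \<Rightarrow> nat \<Rightarrow> real) \<Rightarrow> (nat \<Rightarrow> nat \<Rightarrow> real) \<Rightarrow> bool" where
  "is_matrix_product C A B \<longleftrightarrow>
     (\<forall>i k. finite {m. A i m * B m k \<noteq> 0} \<and>
            C i k = (\<Sum>m | A i m * B m k \<noteq> 0. A i m * B m k))"

end

theory Submission
  imports Defs "HOL-Complex_Analysis.Conformal_Mappings"
begin

text \<open>
Let \<open>S\<close> be the linear functional on polynomials with moments \<open>s\<close> and \<open>T\<close> the one with the
shifted moments \<open>sm1, s 0, s 1, \<dots>\<close>, so that \<open>T (x * p) = S p\<close> and \<open>T 1 = sm1\<close>. Let \<open>P n\<close> be
the monic orthogonal polynomials of \<open>S\<close>. The value \<open>H n\<close> of the polynomial \<open>hat_poly\<close> at 0 is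
\<open>T (P n)\<close> (lemma \<open>hat_poly_at_0\<close>).

A vector in the kernel of the Hankel matrix of order \<open>n + 1\<close> of the shifted sequence is a polynomial
\<open>p\<close> of degree at most \<open>n\<close> which \<open>T\<close> annihilates after multiplication by \<open>1, x, \<dots>, x ^ n\<close>.
The powers from \<open>x\<close> on make \<open>p\<close> a multiple of \<open>P n\<close>, and then the power 1 requires
\<open>T (P n) = 0\<close>. Hence \<open>n + 1\<close> is a normal index exactly if \<open>H n \<noteq> 0\<close> (lemma
\<open>det_hankel_eq_0_iff\<close>).

The numbers \<open>H n\<close> satisfy the three-term recurrence of the Jacobi matrix at 0. Since the \<open>c j\<close> are
nonzero and \<open>H 0 = sm1\<close>, \<open>H 1 = s 0 - b 0 * sm1\<close>, two consecutive zeros can only occur if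
\<open>s 0 = 0\<close>. The Nevanlinna function excludes this: by Schwarz-Pick, \<open>Im (F (\<i> y))\<close> decays no faster
than \<open>1 / y\<close> (lemma \<open>nevanlinna_first_coefficient_pos\<close>). So there are infinitely many normal
indices, with gaps 1 and 2.

Finally the factorization is checked row by row. Those of its conditions that do not just choose an
entry are instances of the recurrence for \<open>H\<close>: where \<open>H\<close> vanishes, a block of size 2 avoids the division by zero that stops the
elimination with scalar pivots (lemma \<open>upper_lower_factorization\<close>).
\<close>

section \<open>Positivity of the leading asymptotic coefficient\<close>

text \<open>A Nevanlinna function does not increase hyperbolic distances (Schwarz-Pick), and the hyperbolic
distance from \<open>\<i>\<close> to \<open>\<i> y\<close> is \<open>ln y\<close>. An imaginary part can drop at most by the factor
\<open>exp (- d)\<close> over a hyperbolic distance \<open>d\<close>. The proof moves both half-planes to the unit disc by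
Cayley transforms and applies the Schwarz lemma there.\<close>

lemma nevanlinna_lower_bound_imaginary_axis:
  assumes F: "F \<in> nevanlinna" and y: "1 \<le> y"
  shows "Im (F \<i>) / y \<le> Im (F (\<i> * of_real y))"
proof -
  define w0 where "w0 = F \<i>"
  define \<phi> where "\<phi> \<zeta> = \<i> * ((1 + \<zeta>) / (1 - \<zeta>))" for \<zeta> :: complex
  define g where "g \<zeta> = (F (\<phi> \<zeta>) - w0) / (F (\<phi> \<zeta>) - cnj w0)" for \<zeta>
  have hol: "F holomorphic_on {z. 0 < Im z}" and pos: "\<And>z. 0 < Im z \<Longrightarrow> 0 < Im (F z)"
    using F by (auto simp: nevanlinna_def analytic_imp_holomorphic)
  have v0: "0 < Im w0"
    using pos[of \<i>] by (simp add: w0_def)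
  have ne1: "1 - \<zeta> \<noteq> 0" if "norm \<zeta> < 1" for \<zeta> :: complex
    using that by auto
  have phi_pos: "0 < Im (\<phi> \<zeta>)" if "norm \<zeta> < 1" for \<zeta>
  proof -
    have "(Re \<zeta>)\<^sup>2 + (Im \<zeta>)\<^sup>2 < 1"
      using that by (metis cmod_power2 norm_ge_zero power_less_one_iff pos2)
    moreover have "0 < (1 - Re \<zeta>)\<^sup>2 + (Im \<zeta>)\<^sup>2"
      using ne1[OF that] by (auto simp: complex_eq_iff sum_power2_gt_zero_iff)
    moreover have "Im (\<phi> \<zeta>) = (1 - ((Re \<zeta>)\<^sup>2 + (Im \<zeta>)\<^sup>2)) / ((1 - Re \<zeta>)\<^sup>2 + (Im \<zeta>)\<^sup>2)"
      by (simp add: \<phi>_def Im_divide power2_eq_square algebra_simps)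
    ultimately show ?thesis by simp
  qed
  \<comment> \<open>Points of the upper half-plane are closer to \<open>w0\<close> than to its mirror image, so \<open>g\<close> maps into
    the unit disc.\<close>
  have dist: "cmod (w - w0) < cmod (w - cnj w0)" if "0 < Im w" for w
  proof -
    have "(cmod (w - w0))\<^sup>2 < (cmod (w - cnj w0))\<^sup>2"
      using mult_pos_pos[OF that v0] unfolding cmod_power2
      by (simp add: power2_eq_square algebra_simps)
    then show ?thesis by (rule power2_less_imp_less) simp
  qed
  have "g holomorphic_on ball 0 1"
  proof -
    have "\<phi> holomorphic_on ball 0 1"
      unfolding \<phi>_def by (intro holomorphic_intros) (use ne1 in auto)
    then have "(F \<circ> \<phi>) holomorphic_on ball 0 1"
      by (rule holomorphic_on_compose_gen[OF _ hol]) (use phi_pos in auto)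
    then have "(\<lambda>\<zeta>. F (\<phi> \<zeta>)) holomorphic_on ball 0 1"
      by (simp add: comp_def)
    moreover have "F (\<phi> \<zeta>) - cnj w0 \<noteq> 0" if "\<zeta> \<in> ball 0 1" for \<zeta>
      using dist[OF pos[OF phi_pos]] that by fastforce
    ultimately show ?thesis
      unfolding g_def by (intro holomorphic_intros) auto
  qed
  moreover have "g 0 = 0"
    by (simp add: g_def \<phi>_def w0_def)
  moreover have "cmod (g \<zeta>) < 1" if "cmod \<zeta> < 1" for \<zeta>
    using dist[OF pos[OF phi_pos[OF that]]] unfolding g_def
    by (simp add: norm_divide divide_less_eq_1)
  ultimately have schwarz: "cmod (g \<zeta>) \<le> cmod \<zeta>" if "cmod \<zeta> < 1" for \<zeta>
    using Schwarz_Lemma(1)[of g \<zeta>] that by blast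
  \<comment> \<open>The point of the disc that \<open>\<phi>\<close> sends to \<open>\<i> y\<close>.\<close>
  define r where "r = (y - 1) / (y + 1)"
  define w where "w = F (\<i> * of_real y)"
  have r: "0 \<le> r" "r < 1"
    using y by (auto simp: r_def field_simps)
  have "\<phi> (of_real r) = \<i> * of_real y"
  proof -
    have "(1 + r) / (1 - r) = y"
      using y by (simp add: r_def field_simps)
    then show ?thesis
      unfolding \<phi>_def by (metis of_real_1 of_real_add of_real_diff of_real_divide)
  qed
  then have "cmod (w - w0) / cmod (w - cnj w0) \<le> r"
    using schwarz[of "of_real r"] r by (simp add: g_def w_def norm_divide)
  moreover have vpos: "0 < Im w"
    using pos[of "\<i> * of_real y"] y by (simp add: w_def)
  then have "0 < cmod (w - cnj w0)"
    using dist[of w] by (metis norm_ge_zero order_le_less_trans)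
  ultimately have "cmod (w - w0) \<le> r * cmod (w - cnj w0)"
    by (simp add: field_simps)
  then have "(cmod (w - w0))\<^sup>2 \<le> r\<^sup>2 * (cmod (w - cnj w0))\<^sup>2"
    by (metis norm_ge_zero power_mono power_mult_distrib)
  then have "(1 - r\<^sup>2) * (Re w - Re w0)\<^sup>2 + (Im w - Im w0)\<^sup>2 \<le> (r * (Im w + Im w0))\<^sup>2"
    unfolding cmod_power2 power_mult_distrib by (simp add: distrib_left left_diff_distrib)
  moreover have "0 \<le> (1 - r\<^sup>2) * (Re w - Re w0)\<^sup>2"
    using r by (intro mult_nonneg_nonneg) (auto simp: power_le_one)
  ultimately have "(Im w0 - Im w)\<^sup>2 \<le> (r * (Im w + Im w0))\<^sup>2"
    by (simp add: power2_commute)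
  then have "Im w0 - Im w \<le> r * (Im w + Im w0)"
    using r v0 vpos by (intro power2_le_imp_le[OF _ mult_nonneg_nonneg]) auto
  then have "(y + 1) * (Im w0 - Im w) \<le> (y - 1) * (Im w + Im w0)"
    using y by (simp add: r_def pos_le_divide_eq mult.commute)
  then show ?thesis
    using y by (simp add: w0_def w_def field_simps)
qed

text \<open>Along the imaginary axis \<open>y * Im (F (\<i> y))\<close> tends to \<open>s 0\<close>, while the preceding bound keeps it
above \<open>Im (F \<i>) > 0\<close>. If \<open>s\<close> has orthogonal polynomials, then \<open>s 0 = 0\<close> would
force all moments to vanish and leave at most one normal index.\<close>

lemma nevanlinna_first_coefficient_pos:
  assumes F: "F \<in> nevanlinna" and s: "asymptotic_coefficients F s"
  shows "0 < s 0"
proof -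
  define A where "A y = \<i> * of_real y" for y :: real
  have A_lim: "filterlim A (sector_at_infinity 1) at_top"
    unfolding sector_at_infinity_def filterlim_inf
  proof
    show "filterlim A at_infinity at_top"
      unfolding A_def by (rule tendsto_mult_filterlim_at_infinity[OF tendsto_const])
        (auto intro: filterlim_of_real_at_infinity)
    have "eventually (\<lambda>y. A y \<in> {z. 1 < Arg z \<and> Arg z < pi - 1}) at_top"
    proof (rule eventually_mono[OF eventually_gt_at_top[of 0]])
      fix y :: real
      assume "0 < y"
      then have "Arg (A y) = pi / 2"
        unfolding A_def by (simp add: Arg_times_of_real2 mult.commute)
      then show "A y \<in> {z. 1 < Arg z \<and> Arg z < pi - 1}"
        using pi_gt3 by simp
    qed
    then show "filterlim A (principal {z. 1 < Arg z \<and> Arg z < pi - 1}) at_top"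
      by (simp add: filterlim_principal)
  qed
  have "(\<lambda>z. F z + of_real (s 0) / z) \<in> o[sector_at_infinity 1](\<lambda>z. 1 / z)"
    using s unfolding asymptotic_coefficients_def by (auto dest!: spec[of _ 1] spec[of _ "0::nat"])
  then have "(\<lambda>y. F (A y) + of_real (s 0) / A y) \<in> o(\<lambda>y. 1 / A y)"
    by (rule landau_o.small.compose[OF _ A_lim])
  then have "((\<lambda>y. (F (A y) + of_real (s 0) / A y) / (1 / A y)) \<longlongrightarrow> 0) at_top"
    by (rule smalloD_tendsto)
  then have "((\<lambda>y. Re ((F (A y) + of_real (s 0) / A y) / (1 / A y))) \<longlongrightarrow> 0) at_top"
    using tendsto_Re by fastforce
  moreover have "eventually (\<lambda>y. Re ((F (A y) + of_real (s 0) / A y) / (1 / A y))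
      \<le> s 0 - Im (F \<i>)) at_top"
  proof (rule eventually_mono[OF eventually_ge_at_top[of 1]])
    fix y :: real
    assume y: "1 \<le> y"
    then have eq: "(F (A y) + of_real (s 0) / A y) / (1 / A y) = F (A y) * A y + of_real (s 0)"
      by (simp add: A_def distrib_right)
    show "Re ((F (A y) + of_real (s 0) / A y) / (1 / A y)) \<le> s 0 - Im (F \<i>)"
      using nevanlinna_lower_bound_imaginary_axis[OF F y] y
      unfolding eq by (simp add: A_def field_simps)
  qed
  ultimately have "0 \<le> s 0 - Im (F \<i>)"
    by (rule tendsto_upperbound) simp
  moreover have "0 < Im (F \<i>)"
    using F by (simp add: nevanlinna_def)
  ultimately show ?thesis by simp
qed

section \<open>Moment functionals and orthogonal polynomials\<close>

lemma moment_functional_eq_sum: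
  assumes "degree p \<le> n"
  shows "moment_functional s p = (\<Sum>i\<le>n. coeff p i * s i)"
  unfolding moment_functional_def
  by (rule sum.mono_neutral_left) (use assms in \<open>auto simp: coeff_eq_0\<close>)

lemma moment_functional_0 [simp]: "moment_functional s 0 = 0"
  by (simp add: moment_functional_def)

lemma moment_functional_1 [simp]: "moment_functional s 1 = s 0"
  by (simp add: moment_functional_def)

lemma moment_functional_add:
  "moment_functional s (p + q) = moment_functional s p + moment_functional s q"
proof -
  let ?n = "max (degree p) (degree q)"
  have "moment_functional s (p + q) = (\<Sum>i\<le>?n. coeff (p + q) i * s i)"
    by (rule moment_functional_eq_sum) (rule degree_add_le_max)
  also have "\<dots> = (\<Sum>i\<le>?n. coeff p i * s i) + (\<Sum>i\<le>?n. coeff q i * s i)"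
    by (simp add: sum.distrib distrib_right)
  finally show ?thesis
    by (simp add: moment_functional_eq_sum[of p ?n] moment_functional_eq_sum[of q ?n])
qed

lemma moment_functional_smult:
  "moment_functional s (Polynomial.smult a p) = a * moment_functional s p"
  by (simp add: moment_functional_eq_sum[of "Polynomial.smult a p" "degree p"]
      moment_functional_eq_sum[of p "degree p"] sum_distrib_left mult.assoc)

lemma moment_functional_diff:
  "moment_functional s (p - q) = moment_functional s p - moment_functional s q"
  using moment_functional_add[of s "p - q" q] by simp

text \<open>Multiplying a polynomial by the variable shifts the moment sequence. For the sequence
\<open>case_nat a s\<close> this says that its functional at \<open>x * p\<close> is the functional of \<open>s\<close> at \<open>p\<close>.\<close>

lemma moment_functional_pCons:
  "moment_functional s (pCons a p) = a * s 0 + moment_functional (\<lambda>i. s (Suc i)) p"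
proof -
  have "moment_functional s (pCons a p) = (\<Sum>i\<le>Suc (degree p). coeff (pCons a p) i * s i)"
    by (rule moment_functional_eq_sum) (simp add: degree_pCons_le)
  then show ?thesis
    by (simp add: sum.atMost_Suc_shift moment_functional_def del: sum.atMost_Suc)
qed

lemma moment_functional_monom_mult:
  "moment_functional s (monom 1 i * p) = moment_functional (\<lambda>k. s (i + k)) p"
  by (induction i arbitrary: s) (simp_all add: monom_Suc moment_functional_pCons)

lemma first_kind_monic: "degree (first_kind b c n) = n \<and> coeff (first_kind b c n) n = 1"
proof (induction b c n rule: first_kind.induct)
  case (3 b c j)
  let ?P = "first_kind b c (Suc j)" and ?R = "first_kind b c j"
  have eq: "first_kind b c (Suc (Suc j))
      = pCons 0 ?P + (Polynomial.smult (- b (Suc j)) ?P - Polynomial.smult (c j) ?R)"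
    by simp
  have "degree (pCons 0 ?P) = Suc (Suc j)"
    using 3 by (metis degree_pCons_eq_if coeff_0 zero_neq_one)
  moreover have "degree (Polynomial.smult (- b (Suc j)) ?P - Polynomial.smult (c j) ?R) < Suc (Suc j)"
    using 3 by (intro degree_diff_less) (auto simp: le_imp_less_Suc)
  ultimately show ?case
    unfolding eq using 3 by (auto simp: degree_add_eq_left coeff_eq_0)
qed auto

text \<open>The orthogonal polynomials of degrees below \<open>n\<close> span all polynomials of degree below \<open>n\<close>: subtract the
leading term of \<open>q\<close> as a multiple of the polynomial of the same degree and induct.\<close>

lemma jacobi_orthogonal_lower:
  assumes J: "jacobi_coefficients s b c"
  shows "degree q < n \<Longrightarrow> moment_functional s (first_kind b c n * q) = 0"
proof (induction "degree q" arbitrary: q rule: less_induct)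
  case less
  let ?d = "degree q"
  let ?P = "first_kind b c"
  let ?r = "q - Polynomial.smult (lead_coeff q) (?P ?d)"
  have orth: "moment_functional s (?P n * ?P ?d) = 0"
    using J less.prems unfolding jacobi_coefficients_def by auto
  have split: "moment_functional s (?P n * q) =
      lead_coeff q * moment_functional s (?P n * ?P ?d) + moment_functional s (?P n * ?r)"
    by (simp add: right_diff_distrib moment_functional_diff moment_functional_smult)
  show ?case
  proof (cases "?d = 0")
    case True
    then have "?r = 0"
      by (auto elim!: degree_eq_zeroE)
    then show ?thesis using split orth by simp
  next
    case False
    have "degree ?r \<le> ?d"
      using degree_diff_le_max[of q "Polynomial.smult (lead_coeff q) (?P ?d)"]
        first_kind_monic[of b c ?d] by (auto intro: order_trans)
    moreover have "coeff ?r ?d = 0"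
      using first_kind_monic[of b c ?d] by simp
    ultimately have "degree ?r < ?d"
      using False by (metis le_neq_implies_less leading_coeff_0_iff degree_0)
    then have "moment_functional s (?P n * ?r) = 0"
      using less by simp
    then show ?thesis using split orth by simp
  qed
qed

text \<open>By the recurrence, both \<open>P (Suc n) * P (Suc n)\<close> and \<open>c n * (P n * P n)\<close> have the same functional
value as \<open>x * P n * P (Suc n)\<close>, so the square norms are \<open>s 0 * c 0 * \<dots> * c (n - 1)\<close>.\<close>

lemma jacobi_norm_nonzero:
  assumes J: "jacobi_coefficients s b c" and s0: "s 0 \<noteq> 0"
  shows "moment_functional s (first_kind b c n * first_kind b c n) \<noteq> 0"
proof (induction n)
  case 0
  show ?case using s0 by simp
next
  case (Suc n)
  let ?P = "first_kind b c"
  have orth: "moment_functional s (?P i * ?P j) = 0" if "i \<noteq> j" for i j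
    using J that unfolding jacobi_coefficients_def by auto
  have rec: "[:0, 1:] * ?P (Suc n) = ?P (Suc (Suc n))
      + Polynomial.smult (b (Suc n)) (?P (Suc n)) + Polynomial.smult (c n) (?P n)"
    by simp
  have x1: "moment_functional s (?P n * ([:0, 1:] * ?P (Suc n)))
      = c n * moment_functional s (?P n * ?P n)"
    unfolding rec by (simp only: distrib_left moment_functional_add mult_smult_right
        moment_functional_smult) (simp add: orth del: first_kind.simps)
  have "degree ([:0, 1:] * ?P n - ?P (Suc n)) < Suc n"
  proof -
    have "degree ([:0, 1:] * ?P n) \<le> Suc n"
      using first_kind_monic[of b c n] degree_pCons_le[of 0 "?P n"] by auto
    then have "degree ([:0, 1:] * ?P n - ?P (Suc n)) \<le> Suc n"
      using first_kind_monic[of b c "Suc n"] by (intro degree_diff_le) (auto simp del: first_kind.simps)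
    moreover have "coeff ([:0, 1:] * ?P n - ?P (Suc n)) (Suc n) = 0"
      using first_kind_monic[of b c n] first_kind_monic[of b c "Suc n"]
      by (simp del: first_kind.simps)
    ultimately show ?thesis
      by (metis degree_0 le_neq_implies_less leading_coeff_0_iff zero_less_Suc)
  qed
  then have "moment_functional s (?P (Suc n) * ([:0, 1:] * ?P n - ?P (Suc n))) = 0"
    by (rule jacobi_orthogonal_lower[OF J])
  then have "moment_functional s (?P (Suc n) * ?P (Suc n))
      = moment_functional s (?P (Suc n) * ([:0, 1:] * ?P n))"
    by (simp only: right_diff_distrib moment_functional_diff)
  also have "\<dots> = c n * moment_functional s (?P n * ?P n)"
    using x1 by (simp only: mult.left_commute mult.commute)
  finally show ?case
    using Suc J unfolding jacobi_coefficients_def by (metis less_irrefl mult_eq_0_iff)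
qed

lemma moment_functional_eq_0_if_monomials:
  assumes "\<And>i. i < n \<Longrightarrow> moment_functional s (monom 1 i * p) = 0" and "degree q < n"
  shows "moment_functional s (q * p) = 0"
proof -
  have "moment_functional s ((\<Sum>i\<in>I. monom (coeff q i) i) * p) = 0" if "finite I" "I \<subseteq> {..<n}" for I
    using that
  proof (induction I rule: finite_induct)
    case (insert i I)
    have "monom (coeff q i) i = Polynomial.smult (coeff q i) (monom 1 i)"
      by (simp add: smult_monom)
    then show ?case
      using insert assms(1)[of i]
      by (simp add: distrib_right moment_functional_add moment_functional_smult)
  qed simp
  moreover have "{..degree q} \<subseteq> {..<n}"
    using assms(2) by auto
  ultimately show ?thesis
    using poly_as_sum_of_monoms[of q] by (metis finite_atMost)
qed

text \<open>Subtract from \<open>p\<close> the multiple of the \<open>n\<close>-th polynomial that cancels the coefficient of degree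
\<open>n\<close>. If the remainder were nonzero, of degree \<open>d < n\<close>, then pairing it with the \<open>d\<close>-th
polynomial would give its leading coefficient times a nonzero square norm, and also 0.\<close>

lemma jacobi_orthogonal_complement:
  assumes J: "jacobi_coefficients s b c" and s0: "s 0 \<noteq> 0"
    and deg: "degree p \<le> n"
    and orth: "\<And>q. degree q < n \<Longrightarrow> moment_functional s (q * p) = 0"
  shows "p = Polynomial.smult (coeff p n) (first_kind b c n)"
proof (rule ccontr)
  let ?P = "first_kind b c"
  define r where "r = p - Polynomial.smult (coeff p n) (?P n)"
  define d where "d = degree r"
  assume "\<not> ?thesis"
  then have r0: "r \<noteq> 0"
    by (simp add: r_def)
  have "degree r \<le> n"
    unfolding r_def using first_kind_monic[of b c n] deg by (intro degree_diff_le) auto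
  moreover have "coeff r n = 0"
    unfolding r_def using first_kind_monic[of b c n] by simp
  ultimately have dn: "d < n"
    unfolding d_def using r0 by (metis le_neq_implies_less leading_coeff_0_iff)
  have "moment_functional s (?P d * r) = 0"
    using orth[of "?P d"] jacobi_orthogonal_lower[OF J, of "?P d" n] first_kind_monic[of b c d] dn
    by (simp add: r_def right_diff_distrib moment_functional_diff moment_functional_smult mult.commute)
  moreover have "moment_functional s (?P d * r)
      = lead_coeff r * moment_functional s (?P d * ?P d)"
  proof -
    let ?t = "r - Polynomial.smult (lead_coeff r) (?P d)"
    have "moment_functional s (?P d * ?t) = 0"
    proof (cases "d = 0")
      case True
      then have "?t = 0"
        by (auto simp: d_def elim!: degree_eq_zeroE)
      then show ?thesis by simp
    next
      case False
      have "degree ?t \<le> d"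
        using first_kind_monic[of b c d] by (intro degree_diff_le) (auto simp: d_def)
      moreover have "coeff ?t d = 0"
        using first_kind_monic[of b c d] by (simp add: d_def)
      ultimately have "degree ?t < d"
        using False by (metis le_neq_implies_less leading_coeff_0_iff degree_0)
      then show ?thesis
        by (rule jacobi_orthogonal_lower[OF J])
    qed
    then show ?thesis
      by (simp add: right_diff_distrib moment_functional_diff moment_functional_smult)
  qed
  ultimately show False
    using jacobi_norm_nonzero[OF J s0, of d] r0 by simp
qed

section \<open>Normal indices of the shifted sequence\<close>

text \<open>With \<open>T\<close> the functional of \<open>case_nat a s\<close>, the value at 0 of the second kind polynomial is the
moment functional of \<open>(P n - P n 0) / x\<close>, which is \<open>T (P n - P n 0)\<close>, and \<open>a * P n 0\<close> is
\<open>T\<close> of the constant \<open>P n 0\<close>. The proof instead checks that both sides obey the same recurrence: the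
term \<open>T (x * P n)\<close> is the pairing of \<open>P n\<close> with 1 and disappears for positive \<open>n\<close>.\<close>

lemma hat_poly_at_0:
  assumes J: "jacobi_coefficients s b c"
  shows "poly (hat_poly a s b c n) 0 = moment_functional (case_nat a s) (first_kind b c n)"
proof (induction n rule: induct_nat_012)
  case 0
  show ?case by (simp add: hat_poly_def)
next
  case 1
  show ?case by (simp add: hat_poly_def moment_functional_pCons moment_functional_def)
next
  case (ge2 j)
  let ?P = "first_kind b c"
  have "moment_functional s (?P (Suc j) * 1) = 0"
    by (rule jacobi_orthogonal_lower[OF J]) simp
  then have "moment_functional (case_nat a s) (pCons 0 (?P (Suc j))) = 0"
    by (simp add: moment_functional_pCons)
  moreover have "?P (Suc (Suc j)) = Polynomial.smult (- b (Suc j)) (?P (Suc j))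
      + pCons 0 (?P (Suc j)) - Polynomial.smult (c j) (?P j)"
    by simp
  ultimately have "moment_functional (case_nat a s) (?P (Suc (Suc j))) =
      - b (Suc j) * poly (hat_poly a s b c (Suc j)) 0 - c j * poly (hat_poly a s b c j) 0"
    using ge2 by (simp only: moment_functional_add moment_functional_diff moment_functional_smult)
  then show ?case
    by (simp add: hat_poly_def algebra_simps)
qed

text \<open>A kernel vector of the Hankel matrix is a nonzero polynomial \<open>p\<close> of degree at most \<open>n\<close> with
\<open>T (x ^ i * p) = 0\<close> for \<open>i \<le> n\<close>. The equations with \<open>i \<ge> 1\<close> say that \<open>p\<close> is orthogonal, for
\<open>s\<close>, to all polynomials of degree below \<open>n\<close>, so \<open>p\<close> is a multiple of the \<open>n\<close>-th orthogonal
polynomial. The remaining equation, \<open>i = 0\<close>, is the condition on the right.\<close>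

lemma det_hankel_eq_0_iff:
  assumes J: "jacobi_coefficients s b c" and s0: "s 0 \<noteq> 0"
  shows "Determinant.det (hankel (case_nat a s) (Suc n)) = 0 \<longleftrightarrow>
    moment_functional (case_nat a s) (first_kind b c n) = 0"
proof -
  let ?T = "moment_functional (case_nat a s)" and ?P = "first_kind b c"
  let ?A = "hankel (case_nat a s) (Suc n)"
  have A: "?A \<in> carrier_mat (Suc n) (Suc n)"
    by (simp add: hankel_def)
  have shift: "?T (monom 1 (Suc i) * p) = moment_functional s (monom 1 i * p)" for i p
    by (simp add: monom_Suc moment_functional_pCons)
  have mult: "(?A *\<^sub>v vec (Suc n) (coeff p)) $ i = ?T (monom 1 i * p)"
    if "i < Suc n" "degree p \<le> n" for i p
  proof -
    have "(?A *\<^sub>v vec (Suc n) (coeff p)) $ i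
        = (\<Sum>k<Suc n. case_nat a s (i + k) * coeff p k)"
      using that(1) by (simp add: hankel_def scalar_prod_def atLeast0LessThan del: sum.lessThan_Suc)
    also have "\<dots> = moment_functional (\<lambda>k. case_nat a s (i + k)) p"
      by (simp add: moment_functional_eq_sum[OF that(2)] lessThan_Suc_atMost mult.commute
          del: sum.lessThan_Suc sum.atMost_Suc)
    finally show ?thesis
      by (simp add: moment_functional_monom_mult)
  qed
  have kernel: "Determinant.det ?A = 0 \<longleftrightarrow>
      (\<exists>p. p \<noteq> 0 \<and> degree p \<le> n \<and> (\<forall>i\<le>n. ?T (monom 1 i * p) = 0))" (is "_ \<longleftrightarrow> ?K")
  proof
    assume "Determinant.det ?A = 0"
    then obtain v where v: "v \<in> carrier_vec (Suc n)" "v \<noteq> 0\<^sub>v (Suc n)" "?A *\<^sub>v v = 0\<^sub>v (Suc n)"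
      using det_0_iff_vec_prod_zero[OF A] by auto
    define p where "p = (\<Sum>i\<le>n. monom (v $ i) i)"
    have cp: "coeff p i = (if i \<le> n then v $ i else 0)" for i
      by (simp add: p_def coeff_sum)
    have vp: "v = vec (Suc n) (coeff p)"
      using v(1) by (intro eq_vecI) (auto simp: cp)
    have "degree p \<le> n"
      by (rule degree_le) (simp add: cp)
    moreover have "p \<noteq> 0"
      using v(2) unfolding vp by (auto simp: vec_eq_iff)
    moreover have "?T (monom 1 i * p) = 0" if "i \<le> n" for i
      using mult[of i p] v(3) that \<open>degree p \<le> n\<close> by (simp add: vp[symmetric])
    ultimately show ?K by blast
  next
    assume ?K
    then obtain p where p: "p \<noteq> 0" "degree p \<le> n" "\<And>i. i \<le> n \<Longrightarrow> ?T (monom 1 i * p) = 0"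
      by blast
    have "?A *\<^sub>v vec (Suc n) (coeff p) = 0\<^sub>v (Suc n)"
      using A mult[OF _ p(2)] p(3) by (intro eq_vecI) (auto simp: less_Suc_eq_le)
    moreover have "vec (Suc n) (coeff p) \<noteq> 0\<^sub>v (Suc n)"
    proof
      assume eq: "vec (Suc n) (coeff p) = 0\<^sub>v (Suc n)"
      have "coeff p (degree p) = vec (Suc n) (coeff p) $ degree p"
        using p(2) by simp
      then show False
        using p(1,2) unfolding eq by simp
    qed
    ultimately show "Determinant.det ?A = 0"
      using det_0_iff_vec_prod_zero[OF A] by (metis vec_carrier)
  qed
  show ?thesis
  proof
    assume "Determinant.det ?A = 0"
    then obtain p where p: "p \<noteq> 0" "degree p \<le> n" "\<And>i. i \<le> n \<Longrightarrow> ?T (monom 1 i * p) = 0"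
      using kernel by blast
    have "moment_functional s (q * p) = 0" if "degree q < n" for q
      by (rule moment_functional_eq_0_if_monomials[OF _ that]) (use p(3) shift in \<open>metis Suc_leI\<close>)
    then have eq: "p = Polynomial.smult (coeff p n) (?P n)"
      by (rule jacobi_orthogonal_complement[OF J s0 p(2)])
    then have "coeff p n \<noteq> 0" using p(1) by auto
    moreover have "?T p = 0" using p(3)[of 0] by (simp add: monom_0)
    ultimately show "?T (?P n) = 0"
      using eq by (metis moment_functional_smult mult_eq_0_iff)
  next
    assume 0: "?T (?P n) = 0"
    have "?T (monom 1 i * ?P n) = 0" if "i \<le> n" for i
    proof (cases i)
      case 0
      then show ?thesis using \<open>?T (?P n) = 0\<close> by (simp add: monom_0)
    next
      case (Suc k)
      then show ?thesis
        using jacobi_orthogonal_lower[OF J, of "monom 1 k" n] that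
        by (simp only: shift) (simp add: degree_monom_eq mult.commute)
    qed
    then show "Determinant.det ?A = 0"
      using kernel first_kind_monic[of b c n] by (metis coeff_0 order_refl zero_neq_one)
  qed
qed

section \<open>Rows of the block bidiagonal matrices\<close>

lemma block_matrix_entry:
  assumes \<nu>: "strict_mono \<nu>" and r: "r < index_gap \<nu> p" and t: "t < index_gap \<nu> q"
  shows "block_matrix \<nu> B (\<nu> p + r) (\<nu> q + t) = B p q $$ (r, t)"
proof -
  have block: "block_of \<nu> (\<nu> p + r) = p" if "r < index_gap \<nu> p" for p r
    unfolding block_of_def
  proof (rule the_equality)
    show "\<nu> p \<le> \<nu> p + r \<and> \<nu> p + r < \<nu> (Suc p)"
      using that by (auto simp: index_gap_def)
    fix j
    assume "\<nu> j \<le> \<nu> p + r \<and> \<nu> p + r < \<nu> (Suc j)"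
    then have "\<nu> j < \<nu> (Suc p)" "\<nu> p < \<nu> (Suc j)"
      using that by (auto simp: index_gap_def)
    then show "j = p"
      using \<nu> by (simp add: strict_mono_less)
  qed
  show ?thesis
    using block[OF r] block[OF t] by (simp add: block_matrix_def)
qed

lemma is_matrix_productI:
  assumes "\<And>i. \<exists>M. finite M \<and> (\<forall>m. m \<notin> M \<longrightarrow> A i m = 0) \<and> (\<forall>k. C i k = (\<Sum>m\<in>M. A i m * B m k))"
  shows "is_matrix_product C A B"
  unfolding is_matrix_product_def
proof (intro allI)
  fix i k
  obtain M where M: "finite M" "\<forall>m. m \<notin> M \<longrightarrow> A i m = 0" "C i k = (\<Sum>m\<in>M. A i m * B m k)"
    using assms by metis
  then have sub: "{m. A i m * B m k \<noteq> 0} \<subseteq> M"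
    by auto
  show "finite {m. A i m * B m k \<noteq> 0} \<and> C i k = (\<Sum>m | A i m * B m k \<noteq> 0. A i m * B m k)"
    unfolding M(3) using finite_subset[OF sub M(1)] sub M(1)
    by (intro conjI sum.mono_neutral_right) auto
qed

lemma U_block_entry:
  assumes "k \<in> {1, 2}" "r < k" "t < k"
  shows "U_block k u $$ (r, t) =
    (if r = Suc t \<or> k = 1 then u else if t = Suc r then 1 else 0)"
  using assms by (auto simp: U_block_def mat_of_rows_list_def less_2_cases_iff)

lemma E_block_entry:
  assumes "k \<in> {1, 2}" "r < k" "t < k"
  shows "E_block k e $$ (r, t) = (if r = t then 1 else if r = Suc t then e else 0)"
  using assms by (auto simp: E_block_def mat_of_rows_list_def less_2_cases_iff)

context
  fixes \<nu> :: "nat \<Rightarrow> nat"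
  assumes \<nu>: "strict_mono \<nu>" "\<nu> 0 = 0" and gap: "\<And>p. index_gap \<nu> p \<in> {1, 2}"
begin

text \<open>Only blocks adjacent to block \<open>p\<close> can meet its rows, so a column index is classified by the
position of its block relative to \<open>p\<close>. The strict inequalities separate the columns of remote
blocks from the few columns in which a row of block \<open>p\<close> may have a nonzero entry.\<close>

lemma block_index_cases:
  fixes k p :: nat
  obtains (before) q t where "Suc q < p" "t < index_gap \<nu> q" "k = \<nu> q + t" "Suc k < \<nu> p"
  | (previous) q t where "p = Suc q" "t < index_gap \<nu> q" "k = \<nu> q + t" "k < \<nu> p"
  | (same) t where "t < index_gap \<nu> p" "k = \<nu> p + t"
  | (following) t where "t < index_gap \<nu> (Suc p)" "k = \<nu> (Suc p) + t"
  | (after) q t where "Suc p < q" "t < index_gap \<nu> q" "k = \<nu> q + t" "\<nu> (Suc p) < k"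
proof -
  define q where "q = (GREATEST q. \<nu> q \<le> k)"
  have bound: "q \<le> k" if "\<nu> q \<le> k" for q
    using strict_mono_imp_increasing[OF \<nu>(1), of q] that by simp
  have q: "\<nu> q \<le> k"
    unfolding q_def by (rule GreatestI_nat[of _ 0 k]) (use \<nu>(2) bound in auto)
  have q': "k < \<nu> (Suc q)"
  proof (rule ccontr)
    assume "\<not> k < \<nu> (Suc q)"
    then have "Suc q \<le> q"
      unfolding q_def by (intro Greatest_le_nat[of _ _ k]) (use bound in auto)
    then show False by simp
  qed
  obtain t where t: "k = \<nu> q + t" "t < index_gap \<nu> q"
    using q q' that[of "k - \<nu> q"] by (simp add: index_gap_def)
  consider "Suc q < p" | "p = Suc q" | "q = p" | "q = Suc p" | "Suc p < q"
    by linarith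
  then show ?thesis
  proof cases
    case 1
    then have "\<nu> (Suc q) < \<nu> p" using \<nu>(1) by (simp add: strict_mono_less)
    with q' show ?thesis by (intro before[OF 1 t(2,1)]) simp
  next
    case 2
    with q' show ?thesis by (intro previous[OF 2 t(2,1)]) simp
  next
    case 3
    with t show ?thesis by (intro same[of t]) simp_all
  next
    case 4
    with t show ?thesis by (intro following[of t]) simp_all
  next
    case 5
    then have "\<nu> (Suc p) < \<nu> q" using \<nu>(1) by (simp add: strict_mono_less)
    with q show ?thesis by (intro after[OF 5 t(2,1)]) simp
  qed
qed

lemma Suc_index: "\<nu> (Suc p) = \<nu> p + index_gap \<nu> p"
  using \<nu>(1) by (simp add: index_gap_def strict_mono_leD)

lemma gap_pos: "0 < index_gap \<nu> p"
  using gap[of p] by auto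

lemma block_upper_entry:
  assumes "r < index_gap \<nu> p" "t < index_gap \<nu> q"
  shows "block_upper \<nu> u (\<nu> p + r) (\<nu> q + t) =
    (if p = q then if r = Suc t \<or> index_gap \<nu> p = 1 then u p else if t = Suc r then 1 else 0
     else if q = Suc p \<and> Suc r = index_gap \<nu> p \<and> t = 0 then 1 else 0)"
proof -
  note entry = block_upper_def block_matrix_entry[OF \<nu>(1) assms]
  consider "p = q" | "p \<noteq> q" "q = Suc p" | "p \<noteq> q" "\<not> q = Suc p"
    by blast
  then show ?thesis
  proof cases
    case 1
    then show ?thesis
      using U_block_entry[OF gap, of r p t "u p"] assms
      unfolding entry by simp
  next
    case 2
    have "Suc r = m \<longleftrightarrow> r = m - 1" if "r < m" for r m :: nat
      using that by linarith
    then show ?thesis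
      using 2 assms unfolding entry by (simp add: D_block_def)
  next
    case 3
    then show ?thesis
      using assms unfolding entry by simp
  qed
qed

lemma block_lower_entry:
  assumes "r < index_gap \<nu> p" "t < index_gap \<nu> q"
  shows "block_lower \<nu> l e (\<nu> p + r) (\<nu> q + t) =
    (if p = q then if r = t then 1 else if r = Suc t then e p else 0
     else if p = Suc q \<and> Suc r = index_gap \<nu> p \<and> Suc t = index_gap \<nu> q then l p else 0)"
proof -
  note entry = block_lower_def block_matrix_entry[OF \<nu>(1) assms]
  consider "p = q" | "p \<noteq> q" "p = Suc q" | "p \<noteq> q" "\<not> p = Suc q"
    by blast
  then show ?thesis
  proof cases
    case 1
    then show ?thesis
      using E_block_entry[OF gap, of r p t "e p"] assms
      unfolding entry by simp
  next
    case 2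
    have "Suc r = m \<longleftrightarrow> r = m - 1" if "r < m" for r m :: nat
      using that by linarith
    then show ?thesis
      using 2 assms unfolding entry by (simp add: L_block_def)
  next
    case 3
    then show ?thesis
      using assms unfolding entry by simp
  qed
qed

lemma block_upper_first_row:
  "block_upper \<nu> u (\<nu> p) k =
    (if k = Suc (\<nu> p) then 1 else if k = \<nu> p \<and> index_gap \<nu> p = 1 then u p else 0)"
proof (cases rule: block_index_cases[of p k])
  case (before q t)
  show ?thesis
    using block_upper_entry[OF gap_pos[of p] before(2), of u] before gap[of p] Suc_index[of q] by auto
next
  case (previous q t)
  show ?thesis
    using block_upper_entry[OF gap_pos[of p] previous(2), of u] previous gap[of p] Suc_index[of q] by auto
next
  case (same t)
  show ?thesis
    using block_upper_entry[OF gap_pos[of p] same(1), of u] same gap[of p] Suc_index[of p] by auto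
next
  case (following t)
  show ?thesis
    using block_upper_entry[OF gap_pos[of p] following(1), of u] following gap[of p] Suc_index[of p] by auto
next
  case (after q t)
  show ?thesis
    using block_upper_entry[OF gap_pos[of p] after(2), of u] after gap[of p] Suc_index[of p] by auto
qed

lemma block_upper_second_row:
  assumes "index_gap \<nu> p = 2"
  shows "block_upper \<nu> u (Suc (\<nu> p)) k =
    (if k = \<nu> p + 2 then 1 else if k = \<nu> p then u p else 0)"
proof -
  have row: "1 < index_gap \<nu> p"
    using assms by simp
  show ?thesis
  proof (cases rule: block_index_cases[of p k])
    case (before q t)
    show ?thesis
      using block_upper_entry[OF row before(2), of u] before assms Suc_index[of q] by auto
  next
    case (previous q t)
    show ?thesis
      using block_upper_entry[OF row previous(2), of u] previous assms Suc_index[of q] by auto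
  next
    case (same t)
    show ?thesis
      using block_upper_entry[OF row same(1), of u] same assms Suc_index[of p] by auto
  next
    case (following t)
    show ?thesis
      using block_upper_entry[OF row following(1), of u] following assms Suc_index[of p] by auto
  next
    case (after q t)
    show ?thesis
      using block_upper_entry[OF row after(2), of u] after assms Suc_index[of p] by auto
  qed
qed

lemma block_lower_first_row:
  "block_lower \<nu> l e (\<nu> p) k =
    (if k = \<nu> p then 1 else if Suc k = \<nu> p \<and> index_gap \<nu> p = 1 then l p else 0)"
proof (cases rule: block_index_cases[of p k])
  case (before q t)
  show ?thesis
    using block_lower_entry[OF gap_pos[of p] before(2), of l e] before gap[of p] Suc_index[of q] by auto
next
  case (previous q t)
  show ?thesis
    using block_lower_entry[OF gap_pos[of p] previous(2), of l e] previous gap[of p] Suc_index[of q] by auto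
next
  case (same t)
  show ?thesis
    using block_lower_entry[OF gap_pos[of p] same(1), of l e] same gap[of p] Suc_index[of p] by auto
next
  case (following t)
  show ?thesis
    using block_lower_entry[OF gap_pos[of p] following(1), of l e] following gap[of p] Suc_index[of p] by auto
next
  case (after q t)
  show ?thesis
    using block_lower_entry[OF gap_pos[of p] after(2), of l e] after gap[of p] Suc_index[of p] by auto
qed

lemma block_lower_second_row:
  assumes "index_gap \<nu> p = 2"
  shows "block_lower \<nu> l e (Suc (\<nu> p)) k =
    (if k = Suc (\<nu> p) then 1 else if k = \<nu> p then e p else if Suc k = \<nu> p then l p else 0)"
proof -
  have row: "1 < index_gap \<nu> p"
    using assms by simp
  show ?thesis
  proof (cases rule: block_index_cases[of p k])
    case (before q t)
    show ?thesis
      using block_lower_entry[OF row before(2), of l e] before assms Suc_index[of q] by auto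
  next
    case (previous q t)
    show ?thesis
      using block_lower_entry[OF row previous(2), of l e] previous assms Suc_index[of q] by auto
  next
    case (same t)
    show ?thesis
      using block_lower_entry[OF row same(1), of l e] same assms Suc_index[of p] by auto
  next
    case (following t)
    show ?thesis
      using block_lower_entry[OF row following(1), of l e] following assms Suc_index[of p] by auto
  next
    case (after q t)
    show ?thesis
      using block_lower_entry[OF row after(2), of l e] after assms Suc_index[of p] by auto
  qed
qed

section \<open>The factorization\<close>

text \<open>A row of the upper factor has at most two nonzero entries, so each row of the product can be
compared with the entries of the Jacobi matrix. In a block of size 1 at row \<open>i\<close> the conditions are
\<open>u p + l (p + 1) = b i\<close> and, unless \<open>i = 0\<close>, \<open>u p * l p = c (i - 1)\<close>. In a block of size 2 at rows
\<open>i\<close> and \<open>i + 1\<close> they are \<open>e p = b i\<close>, \<open>u p = c i\<close>, \<open>l (p + 1) = b (i + 1)\<close> and, unless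
\<open>i = 0\<close>, \<open>l p = c (i - 1)\<close>. Here \<open>l (p + 1)\<close> counts as 0 when the next block has size 2: its entry
then sits one row lower. Some of these conditions fix \<open>u\<close> and \<open>e\<close>; with the stated quotients for
\<open>l\<close>, each of the others is the recurrence for \<open>H\<close> divided by a nonzero value of \<open>H\<close>.\<close>

lemma upper_lower_factorization:
  fixes H b c :: "nat \<Rightarrow> real"
  assumes gap_iff: "\<And>p. index_gap \<nu> p = 1 \<longleftrightarrow> H (\<nu> p) \<noteq> 0"
    and nonzero: "\<And>p. H (\<nu> (Suc p) - 1) \<noteq> 0"
    and rec: "\<And>j. H (Suc (Suc j)) = - b (Suc j) * H (Suc j) - c j * H j"
  shows "\<exists>l u e. is_matrix_product (monic_jacobi b c) (block_upper \<nu> u) (block_lower \<nu> l e) \<and>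
    (\<forall>j\<ge>1. l j = - H (\<nu> (Suc j) - 1) / H (\<nu> j - 1))"
proof -
  define l where "l p = - H (\<nu> (Suc p) - 1) / H (\<nu> p - 1)" for p
  \<comment> \<open>For size 1 this choice solves the diagonal condition and also works at row 0, where there is no
    subdiagonal entry of the Jacobi matrix.\<close>
  define u where "u p = (if index_gap \<nu> p = 1 then b (\<nu> p) + H (Suc (\<nu> p)) / H (\<nu> p)
    else c (\<nu> p))" for p
  define e where "e p = b (\<nu> p)" for p
  let ?U = "block_upper \<nu> u" and ?L = "block_lower \<nu> l e"
  note rows = block_upper_first_row block_upper_second_row block_lower_first_row block_lower_second_row
  \<comment> \<open>If the next block has size 2, then \<open>H (Suc i) = 0\<close>, so one formula covers both cases.\<close>
  have next_l: "(if index_gap \<nu> (Suc p) = 1 then l (Suc p) else 0) = - H (Suc i) / H i"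
    if "\<nu> (Suc p) = Suc i" for p i
    using gap[of "Suc p"] gap_iff[of "Suc p"] that Suc_index[of "Suc p"] by (auto simp: l_def)
  have prev: "H i \<noteq> 0" if "\<nu> p = Suc i" for p i
  proof (cases p)
    case (Suc q)
    then show ?thesis
      using nonzero[of q] that by simp
  qed (use \<nu>(2) that in simp)
  have "is_matrix_product (monic_jacobi b c) ?U ?L"
  proof (rule is_matrix_productI)
    fix i
    obtain p r where r: "r < index_gap \<nu> p" "i = \<nu> p + r"
      by (rule block_index_cases[of 0 i]) auto
    consider (single) "index_gap \<nu> p = 1" "i = \<nu> p"
      | (first) "index_gap \<nu> p = 2" "i = \<nu> p"
      | (second) "index_gap \<nu> p = 2" "i = Suc (\<nu> p)"
      using r gap[of p] by fastforce
    then show "\<exists>M. finite M \<and> (\<forall>m. m \<notin> M \<longrightarrow> ?U i m = 0) \<and>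
        (\<forall>k. monic_jacobi b c i k = (\<Sum>m\<in>M. ?U i m * ?L m k))"
    proof cases
      case single
      have suc: "\<nu> (Suc p) = Suc i"
        using single Suc_index[of p] by simp
      have Hi: "H i \<noteq> 0"
        using gap_iff[of p] single by simp
      have ul: "u p * l p = c j" if j: "i = Suc j" for j
      proof -
        have "b i * H i + H (Suc i) = - c j * H j"
          using rec[of j] j by simp
        then have "u p = - c j * H j / H i"
          using Hi single by (simp add: u_def field_simps)
        moreover have "l p = - H i / H j"
          using suc j single by (simp add: l_def)
        ultimately show ?thesis
          using Hi prev[of p j] single j by simp
      qed
      have ub: "u p + (if index_gap \<nu> (Suc p) = 1 then l (Suc p) else 0) = b i"
        unfolding next_l[OF suc] using Hi single by (simp add: u_def field_simps)
      have L: "?L i k = (if k = i then 1 else if Suc k = i then l p else 0)"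
        "?L (Suc i) k = (if k = Suc i then 1 else
          if k = i then if index_gap \<nu> (Suc p) = 1 then l (Suc p) else 0 else 0)" for k
        using rows(3)[of l e p k] rows(3)[of l e "Suc p" k] single suc by auto
      have U: "?U i k = (if k = Suc i then 1 else if k = i then u p else 0)" for k
        using rows(1)[of u p k] single by simp
      show ?thesis
        by (rule exI[of _ "{i, Suc i}"]) (use ul ub in \<open>auto simp: L U monic_jacobi_def\<close>)
    next
      case first
      have H0: "H i = 0"
        using gap_iff[of p] first by simp
      have lp: "l p = c j" if j: "i = Suc j" for j
      proof -
        have "H (Suc i) = - c j * H j"
          using rec[of j] H0 j by simp
        moreover have "l p = - H (Suc i) / H j"
          using Suc_index[of p] j first by (simp add: l_def)
        ultimately show ?thesis
          using prev[of p j] first j by simp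
      qed
      have L: "?L (Suc i) k = (if k = Suc i then 1 else if k = i then b i else
          if Suc k = i then l p else 0)" for k
        using rows(4)[of p l e k] first by (simp add: e_def)
      have U: "?U i k = (if k = Suc i then 1 else 0)" for k
        using rows(1)[of u p k] first by simp
      show ?thesis
        by (rule exI[of _ "{Suc i}"]) (use lp in \<open>auto simp: L U monic_jacobi_def\<close>)
    next
      case second
      have suc: "\<nu> (Suc p) = Suc i"
        using second Suc_index[of p] by simp
      have H0: "H (\<nu> p) = 0" "H i \<noteq> 0"
        using gap_iff[of p] prev[OF suc] second by auto
      have lb: "(if index_gap \<nu> (Suc p) = 1 then l (Suc p) else 0) = b i"
        unfolding next_l[OF suc] using H0 second rec[of "\<nu> p"] by simp
      have L: "?L (\<nu> p) k = (if k = \<nu> p then 1 else 0)"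
        "?L (Suc i) k = (if k = Suc i then 1 else
          if k = i then if index_gap \<nu> (Suc p) = 1 then l (Suc p) else 0 else 0)" for k
        using rows(3)[of l e p k] rows(3)[of l e "Suc p" k] second suc by auto
      have U: "?U i k = (if k = Suc i then 1 else if k = \<nu> p then c (\<nu> p) else 0)" for k
        using rows(2)[of p u k] second by (simp add: u_def)
      show ?thesis
        by (rule exI[of _ "{\<nu> p, Suc i}"]) (use lb in \<open>auto simp: second(2) monic_jacobi_def
            L[unfolded second(2)] U[unfolded second(2)]\<close>)
    qed
  qed
  then show ?thesis
    unfolding l_def by blast
qed

end

text \<open>If of two successive positive integers at least one is a normal index, the enumeration advances
by 1 or 2. This also covers the step from the conventional index 0, because normal indices are
positive.\<close>

lemma
  assumes step: "\<And>n. 1 \<le> n \<Longrightarrow> n \<in> normal_indices s \<or> Suc n \<in> normal_indices s"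
  shows normal_indices_infinite: "infinite (normal_indices s)"
    and strict_mono_normal_index: "strict_mono (normal_index s)"
    and index_gap_normal_index: "index_gap (normal_index s) p \<in> {1, 2}"
    and index_gap_normal_index_eq_1:
      "index_gap (normal_index s) p = 1 \<longleftrightarrow> Suc (normal_index s p) \<in> normal_indices s"
    and normal_index_in: "normal_index s (Suc p) \<in> normal_indices s"
proof -
  let ?N = "normal_indices s"
  show inf: "infinite ?N"
    unfolding infinite_nat_iff_unbounded_le
  proof
    fix m
    show "\<exists>n\<ge>m. n \<in> ?N"
      using step[of "Suc m"] by (metis le_SucI order_refl Suc_le_mono le0 One_nat_def)
  qed
  show mem: "normal_index s (Suc p) \<in> ?N" for p
    by (simp add: normal_index_def enumerate_in_set[OF inf])
  have least: "normal_index s (Suc p) = (LEAST n. n \<in> ?N \<and> normal_index s p < n)" for p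
  proof (cases p)
    case 0
    have "n \<in> ?N \<longleftrightarrow> n \<in> ?N \<and> 0 < n" for n
      by (auto simp: normal_indices_def)
    then show ?thesis
      by (simp add: 0 normal_index_def enumerate_0)
  qed (simp add: normal_index_def enumerate_Suc''[OF inf])
  have gap: "normal_index s (Suc p) = (if Suc (normal_index s p) \<in> ?N then Suc (normal_index s p)
      else normal_index s p + 2)" for p
    unfolding least using step[of "Suc (normal_index s p)"]
    by (auto intro!: Least_equality simp: Suc_le_eq intro: Suc_lessI)
  show "strict_mono (normal_index s)"
    by (rule strict_monoI_Suc) (simp add: gap)
  show "index_gap (normal_index s) p \<in> {1, 2}"
    "index_gap (normal_index s) p = 1 \<longleftrightarrow> Suc (normal_index s p) \<in> ?N"
    by (auto simp: index_gap_def gap)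
qed

theorem proposition4p3:
  fixes F :: "complex \<Rightarrow> complex"
    and s b c :: "nat \<Rightarrow> real"
    and sm1 :: real
  defines "ss \<equiv> case_nat sm1 s"
    and "\<nu> \<equiv> normal_index (case_nat sm1 s)"
    and "H \<equiv> (\<lambda>j. poly (hat_poly sm1 s b c j) 0)"
  assumes "F \<in> nevanlinna_minus_infinity"
    and "\<not> rational_on_upper_half_plane F"
    and "asymptotic_coefficients F s"
    and "jacobi_coefficients s b c"
  shows "infinite (normal_indices ss) \<and>
         normal_indices ss = {n. 1 \<le> n \<and> H (n - 1) \<noteq> 0} \<and>
         (\<forall>j. index_gap \<nu> j \<in> {1, 2}) \<and>
         (\<exists>l u e. is_matrix_product (monic_jacobi b c) (block_upper \<nu> u) (block_lower \<nu> l e) \<and>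
                  (\<forall>j\<ge>1. l j = - H (\<nu> (Suc j) - 1) / H (\<nu> j - 1)))"
proof -
  have F: "F \<in> nevanlinna"
    using assms(4) by (simp add: nevanlinna_minus_infinity_def)
  have s0: "s 0 \<noteq> 0"
    using nevanlinna_first_coefficient_pos[OF F assms(6)] by simp
  note J = assms(7)
  have rec: "H (Suc (Suc j)) = - b (Suc j) * H (Suc j) - c j * H j" for j
    by (simp add: H_def hat_poly_def algebra_simps)
  \<comment> \<open>Two consecutive zeros would propagate down the recurrence to \<open>H 0 = sm1\<close> and
    \<open>H 1 = s 0 - b 0 * sm1\<close>, which do not vanish together.\<close>
  have no_consecutive: "H j \<noteq> 0 \<or> H (Suc j) \<noteq> 0" for j
  proof (induction j)
    case 0
    show ?case using s0 by (simp add: H_def hat_poly_def)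
  next
    case (Suc j)
    have "c j \<noteq> 0"
      using J by (metis jacobi_coefficients_def less_irrefl)
    then show ?case
      using Suc rec[of j] by auto
  qed
  have "Determinant.det (hankel ss (Suc j)) = 0 \<longleftrightarrow> H j = 0" for j
    using det_hankel_eq_0_iff[OF J s0] hat_poly_at_0[OF J] by (simp add: ss_def H_def)
  then have normal: "Suc j \<in> normal_indices ss \<longleftrightarrow> H j \<noteq> 0" for j
    by (simp add: normal_indices_def)
  have normal_eq: "normal_indices ss = {n. 1 \<le> n \<and> H (n - 1) \<noteq> 0}"
  proof (rule Set.set_eqI)
    fix n
    show "n \<in> normal_indices ss \<longleftrightarrow> n \<in> {n. 1 \<le> n \<and> H (n - 1) \<noteq> 0}"
      using normal by (cases n) (auto simp: normal_indices_def)
  qed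
  have step: "n \<in> normal_indices ss \<or> Suc n \<in> normal_indices ss" if "1 \<le> n" for n
    using that no_consecutive normal by (cases n) auto
  have \<nu>: "\<nu> = normal_index ss"
    by (simp add: \<nu>_def ss_def)
  have gap: "index_gap \<nu> p \<in> {1, 2}" for p
    unfolding \<nu> by (rule index_gap_normal_index[OF step])
  have "\<exists>l u e. is_matrix_product (monic_jacobi b c) (block_upper \<nu> u) (block_lower \<nu> l e) \<and>
      (\<forall>j\<ge>1. l j = - H (\<nu> (Suc j) - 1) / H (\<nu> j - 1))"
  proof (rule upper_lower_factorization[where H = H and b = b and c = c and \<nu> = \<nu>])
    show "index_gap \<nu> p \<in> {1, 2}" for p
      by (rule gap)
    show "H (Suc (Suc j)) = - b (Suc j) * H (Suc j) - c j * H j" for j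
      by (rule rec)
    show "strict_mono \<nu>"
      unfolding \<nu> by (rule strict_mono_normal_index[OF step])
    show "\<nu> 0 = 0"
      by (simp add: \<nu> normal_index_def)
    show "index_gap \<nu> p = 1 \<longleftrightarrow> H (\<nu> p) \<noteq> 0" for p
      using index_gap_normal_index_eq_1[OF step, of p] normal by (simp add: \<nu>)
    show "H (\<nu> (Suc p) - 1) \<noteq> 0" for p
      using normal_index_in[OF step, of p] normal_eq by (simp add: \<nu>)
  qed
  then show ?thesis
    using normal_indices_infinite[OF step] normal_eq gap by blast
qed

end
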